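(* Let $(\mathcal{P},\mathcal{H})$ be an intersection-closed hypothesis space with least hypotheses $H_P$, $P\in\mathcal{P}$. Let $\varepsilon$ be an E-measure for $\mathcal{H}$, and let $\mathcal{F}$ be a collection of $\mathcal{H}$-order-measurable functions $f:\mathcal{P}\to[0,\infty]$. Then $$\int^E\sup_{f\in\mathcal{F}}f\,d\varepsilon=\sup_{f\in\mathcal{F}}\sup_{P\in\mathcal{P}}\frac{f(P)}{\varepsilon(H_P)}.$$
   Context: $\mathcal{P}$ is a collection of probability measures on a measurable space. A hypothesis class $\mathcal{H}$ is a collection of subsets of $\mathcal{P}$ closed under arbitrary unions (including the empty union, so $\emptyset\in\mathcal{H}$); $(\mathcal{P},\mathcal{H})$ is then a hypothesis space. It is intersection-closed if $\mathcal{H}$ is also closed under arbitrary intersections and $\mathcal{P}\in\mathcal{H}$. In that case the least hypothesis of $P\in\mathcal{P}$ is $H_P=\bigcap\{H\in\mathcal{H}:P\in H\}\in\mathcal{H}$. An E-measure for $\mathcal{H}$ is a map $\varepsilon:\mathcal{H}\to[0,\infty]$ with $\varepsilon(\bigcup_{H\in\mathcal{S}}H)=\inf_{H\in\mathcal{S}}\varepsilon(H)$ for every $\mathcal{S}\subseteq\mathcal{H}$ (with $\inf\emptyset=\infty$, so $\varepsilon(\emptyset)=\infty$). A function $f:\mathcal{P}\to[0,\infty]$ is $\mathcal{H}$-order-measurable if $\{f\ge c\}=\{P\in\mathcal{P}:f(P)\ge c\}\in\mathcal{H}$ for all $c>0$. (Pointwise suprema of such functions are again $\mathcal{H}$-order-measurable.)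 Its E-integral is $\int^E f\,d\varepsilon=\sup_{c>0}\frac{c}{\varepsilon(\{f\ge c\})}$. Conventions: $c/0=\infty$ and $c/\infty=0$ for $c\in(0,\infty]$, $0/0=0$, $0\cdot\infty=0$, $\sup\emptyset=0$. *)

theory Defs
  imports "HOL-Probability.Probability_Measure"
begin

definition hypothesis_space ::
    "'a measure \<Rightarrow> 'a measure set \<Rightarrow> 'a measure set set \<Rightarrow> bool" where
  "hypothesis_space M \<P> \<H> \<longleftrightarrow>
     (\<forall>P\<in>\<P>. prob_space P \<and> sets P = sets M) \<and>
     (\<forall>H\<in>\<H>. H \<subseteq> \<P>) \<and>
     (\<forall>S. S \<subseteq> \<H> \<longrightarrow> \<Union>S \<in> \<H>)"

text \<open>The measure \<open>M\<close> only carries the underlying measurable space; its own measure is never used.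
  The empty intersection, understood inside \<open>\<P>\<close>, is \<open>\<P>\<close>. In HOL it would be
  \<open>UNIV\<close>, so it is excluded from the closure condition and \<open>\<P> \<in> \<H>\<close> is required
  separately.\<close>

definition intersection_closed_space ::
    "'a measure \<Rightarrow> 'a measure set \<Rightarrow> 'a measure set set \<Rightarrow> bool" where
  "intersection_closed_space M \<P> \<H> \<longleftrightarrow>
     hypothesis_space M \<P> \<H> \<and> \<P> \<in> \<H> \<and>
     (\<forall>S. S \<subseteq> \<H> \<and> S \<noteq> {} \<longrightarrow> \<Inter>S \<in> \<H>)"

definition least_hypothesis :: "'a measure set set \<Rightarrow> 'a measure \<Rightarrow> 'a measure set" where
  "least_hypothesis \<H> P = \<Inter>{H\<in>\<H>. P \<in> H}"

text \<open>In \<open>ennreal\<close>, \<open>Inf {} = \<infinity>\<close>. Values of \<open>\<epsilon>\<close> outside \<open>\<H>\<close>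
  are unconstrained.\<close>

definition E_measure :: "'a measure set set \<Rightarrow> ('a measure set \<Rightarrow> ennreal) \<Rightarrow> bool" where
  "E_measure \<H> \<epsilon> \<longleftrightarrow> (\<forall>S. S \<subseteq> \<H> \<longrightarrow> \<epsilon> (\<Union>S) = (INF H\<in>S. \<epsilon> H))"

text \<open>Levels \<open>c\<close> are real. On an intersection-closed space the level \<open>\<infinity>\<close> may be
  added, both here and in the E-integral, without changing anything; see the two lemmas below.\<close>

definition order_measurable ::
    "'a measure set \<Rightarrow> 'a measure set set \<Rightarrow> ('a measure \<Rightarrow> ennreal) \<Rightarrow> bool" where
  "order_measurable \<P> \<H> f \<longleftrightarrow> (\<forall>c::real. c > 0 \<longrightarrow> {P\<in>\<P>. f P \<ge> ennreal c} \<in> \<H>)"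

text \<open>Division and suprema on \<open>ennreal\<close> follow the intended conventions, including
  \<open>0 / 0 = 0\<close>, \<open>c / 0 = \<infinity>\<close> for \<open>c > 0\<close>, \<open>\<infinity> / \<infinity> = 0\<close>
  and \<open>Sup {} = 0\<close>.\<close>

definition E_integral ::
    "'a measure set \<Rightarrow> ('a measure set \<Rightarrow> ennreal) \<Rightarrow> ('a measure \<Rightarrow> ennreal) \<Rightarrow> ennreal" where
  "E_integral \<P> \<epsilon> f = (SUP c\<in>{0::real<..}. ennreal c / \<epsilon> {P\<in>\<P>. f P \<ge> ennreal c})"

lemma top_le_iff_all_levels: "(\<infinity>::ennreal) \<le> x \<longleftrightarrow> (\<forall>c::real. c > 0 \<longrightarrow> ennreal c \<le> x)"
proof (cases x)
  case (real r)
  then have "\<not> ennreal (r + 1) \<le> x" and "r + 1 > 0" by simp_all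
  then show ?thesis using real by (metis infinity_ennreal_def ennreal_neq_top top_unique)
qed simp

lemma order_measurable_iff_ennreal_levels:
  assumes "intersection_closed_space M \<P> \<H>"
  shows "order_measurable \<P> \<H> f \<longleftrightarrow> (\<forall>c::ennreal. c > 0 \<longrightarrow> {P\<in>\<P>. f P \<ge> c} \<in> \<H>)"
proof
  assume f: "order_measurable \<P> \<H> f"
  show "\<forall>c::ennreal. c > 0 \<longrightarrow> {P\<in>\<P>. f P \<ge> c} \<in> \<H>"
  proof (intro allI impI)
    fix c :: ennreal assume "c > 0"
    show "{P\<in>\<P>. f P \<ge> c} \<in> \<H>"
    proof (cases c)
      case (real r)
      with \<open>c > 0\<close> f show ?thesis by (simp add: order_measurable_def)
    next
      case top
      let ?S = "(\<lambda>c. {P\<in>\<P>. f P \<ge> ennreal c}) ` {0<..}"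
      have "{P\<in>\<P>. f P \<ge> c} = \<Inter>?S"
      proof (intro set_eqI)
        fix P
        show "P \<in> {P\<in>\<P>. f P \<ge> c} \<longleftrightarrow> P \<in> \<Inter>?S"
          using top_le_iff_all_levels[of "f P"] zero_less_one[where 'a=real] top
          unfolding infinity_ennreal_def by blast
      qed
      moreover have "?S \<subseteq> \<H>" using f by (auto simp: order_measurable_def)
      moreover have "?S \<noteq> {}" by auto
      ultimately show ?thesis using assms unfolding intersection_closed_space_def by simp
    qed
  qed
qed (auto simp: order_measurable_def)

lemma ennreal_inverse_antimono: "(x::ennreal) \<le> y \<Longrightarrow> inverse y \<le> inverse x"
  including ennreal.lifting by transfer (rule ereal_inverse_antimono)

lemma E_integral_eq_ennreal_levels:
  assumes "intersection_closed_space M \<P> \<H>" "E_measure \<H> \<epsilon>" "order_measurable \<P> \<H> f"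
  shows "E_integral \<P> \<epsilon> f = (SUP c\<in>{0::ennreal<..}. c / \<epsilon> {P\<in>\<P>. f P \<ge> c})"
proof (rule antisym)
  show "E_integral \<P> \<epsilon> f \<le> (SUP c\<in>{0::ennreal<..}. c / \<epsilon> {P\<in>\<P>. f P \<ge> c})"
    unfolding E_integral_def by (rule SUP_mono) (auto intro!: bexI[of _ "ennreal _"])
  let ?A = "\<lambda>c::ennreal. {P\<in>\<P>. f P \<ge> c}"
  have \<H>: "?A c \<in> \<H>" if "c > 0" for c
    using that order_measurable_iff_ennreal_levels[OF assms(1)] assms(3) by simp
  have mono: "\<epsilon> (?A c) \<le> \<epsilon> (?A top)" if "c > 0" for c
  proof -
    have "?A top \<subseteq> ?A c" using order_trans[OF top_greatest[of c]] by blast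
    then have "\<Union>{?A c, ?A top} = ?A c" by blast
    moreover have "{?A c, ?A top} \<subseteq> \<H>" using \<H>[OF that] \<H>[of top] by simp
    then have "\<epsilon> (\<Union>{?A c, ?A top}) = (INF H\<in>{?A c, ?A top}. \<epsilon> H)"
      using assms(2) unfolding E_measure_def by (elim allE impE) assumption+
    ultimately have "\<epsilon> (?A c) = inf (\<epsilon> (?A c)) (\<epsilon> (?A top))" by simp
    then show ?thesis by (rule inf.orderI)
  qed
  have le: "ennreal c / \<epsilon> (?A top) \<le> E_integral \<P> \<epsilon> f" if "c > 0" for c :: real
    unfolding E_integral_def using that mono[of "ennreal c"]
    by (intro SUP_upper2[where i=c])
      (auto simp: divide_ennreal_def intro!: mult_left_mono ennreal_inverse_antimono)
  have *: "top / \<epsilon> (?A top) \<le> E_integral \<P> \<epsilon> f"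
  proof (cases "\<epsilon> (?A top)")
    case (real r)
    have "ennreal d \<le> E_integral \<P> \<epsilon> f" if "d > 0" for d :: real
    proof -
      have "ennreal d \<le> ennreal (d * (r + 1)) / \<epsilon> (?A top)"
      proof (cases "r = 0")
        case False
        then have "ennreal (d * (r + 1)) / \<epsilon> (?A top) = ennreal (d * (r + 1) / r)"
          using that real by (simp add: divide_ennreal del: distrib_left_numeral ennreal_plus)
        moreover have "d \<le> d * (r + 1) / r" using that real False by (simp add: field_simps)
        ultimately show ?thesis by (simp add: ennreal_leI)
      qed (use that real in simp)
      also have "\<dots> \<le> E_integral \<P> \<epsilon> f" using that real by (intro le) simp
      finally show ?thesis .
    qed
    then show ?thesis using top_le_iff_all_levels[of "E_integral \<P> \<epsilon> f"] by (simp add: top_unique)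
  qed simp
  have **: "ennreal c / \<epsilon> (?A (ennreal c)) \<le> E_integral \<P> \<epsilon> f" if "c > 0" for c :: real
    unfolding E_integral_def using that by (intro SUP_upper) auto
  show "(SUP c\<in>{0::ennreal<..}. c / \<epsilon> {P\<in>\<P>. f P \<ge> c}) \<le> E_integral \<P> \<epsilon> f"
  proof (intro SUP_least)
    fix c :: ennreal assume "c \<in> {0<..}"
    then show "c / \<epsilon> (?A c) \<le> E_integral \<P> \<epsilon> f" using * ** by (cases c) auto
  qed
qed

end

theory Submission
  imports Defs
begin

text \<open>The least hypotheses generate: every \<open>H \<in> \<H>\<close> is the union of the \<open>H\<^sub>P\<close> with
  \<open>P \<in> H\<close>, so \<open>\<epsilon> H\<close> is the infimum of the \<open>\<epsilon> H\<^sub>P\<close>. For a single \<open>f\<close> the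
  E-integral is therefore the supremum of \<open>c / \<epsilon> H\<^sub>P\<close> over all \<open>c\<close> and \<open>P\<close> with
  \<open>c \<le> f P\<close>, which is attained at \<open>c = f P\<close>. Apply this to the pointwise supremum, which is again
  order-measurable, and exchange suprema.\<close>

text \<open>Since \<open>A \<union> B = B\<close>, the union rule for the pair makes
  \<open>\<epsilon> B\<close> an infimum over both values.\<close>

lemma E_measure_antimono:
  assumes "E_measure \<H> \<epsilon>" "A \<in> \<H>" "B \<in> \<H>" "A \<subseteq> B"
  shows "\<epsilon> B \<le> \<epsilon> A"
proof -
  have "\<epsilon> (\<Union>{A, B}) = (INF H\<in>{A, B}. \<epsilon> H)"
    using assms(1-3) unfolding E_measure_def by (elim allE[where x="{A, B}"]) blast
  moreover have "\<Union>{A, B} = B"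
    using assms(4) by blast
  ultimately have "\<epsilon> B = inf (\<epsilon> A) (\<epsilon> B)"
    by simp
  then show ?thesis
    by (metis inf.cobounded1)
qed

lemma mem_least_hypothesis: "P \<in> least_hypothesis \<H> P"
  by (simp add: least_hypothesis_def)

lemma least_hypothesis_subset: "H \<in> \<H> \<Longrightarrow> P \<in> H \<Longrightarrow> least_hypothesis \<H> P \<subseteq> H"
  by (auto simp: least_hypothesis_def)

lemma least_hypothesis_in:
  assumes "intersection_closed_space M \<P> \<H>" "P \<in> \<P>"
  shows "least_hypothesis \<H> P \<in> \<H>"
proof -
  \<comment> \<open>The whole space \<open>\<P>\<close> belongs to this family, so it is
    nonempty.\<close>
  have "{H\<in>\<H>. P \<in> H} \<noteq> {}" "{H\<in>\<H>. P \<in> H} \<subseteq> \<H>"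
    using assms unfolding intersection_closed_space_def by blast+
  then show ?thesis
    using assms(1) unfolding intersection_closed_space_def least_hypothesis_def by simp
qed

lemma E_measure_eq_INF_least_hypothesis:
  assumes "intersection_closed_space M \<P> \<H>" "E_measure \<H> \<epsilon>" "H \<in> \<H>"
  shows "\<epsilon> H = (INF P\<in>H. \<epsilon> (least_hypothesis \<H> P))"
proof -
  have "H \<subseteq> \<P>"
    using assms unfolding intersection_closed_space_def hypothesis_space_def by blast
  then have "least_hypothesis \<H> ` H \<subseteq> \<H>"
    using least_hypothesis_in[OF assms(1)] by blast
  then have "\<epsilon> (\<Union>(least_hypothesis \<H> ` H)) = (INF L\<in>least_hypothesis \<H> ` H. \<epsilon> L)"
    using assms(2) unfolding E_measure_def by blast
  moreover have "\<Union>(least_hypothesis \<H> ` H) = H"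
    using least_hypothesis_subset[OF assms(3)] mem_least_hypothesis by blast
  ultimately show ?thesis
    by (simp add: image_image)
qed

text \<open>A supremum need not be attained, so its level set at \<open>c\<close> can exceed the
  union of the level sets at \<open>c\<close>. Reaching \<open>c\<close> means being exceeded at
  every level \<open>d < c\<close>, which gives an intersection of unions.\<close>

lemma order_measurable_SUP:
  assumes "intersection_closed_space M \<P> \<H>"
    and "\<And>f. f \<in> F \<Longrightarrow> order_measurable \<P> \<H> f"
  shows "order_measurable \<P> \<H> (\<lambda>P. SUP f\<in>F. f P)"
  unfolding order_measurable_def
proof (intro allI impI)
  fix c :: real assume "c > 0"
  define U where "U d = (\<Union>f\<in>F. {P\<in>\<P>. f P \<ge> ennreal d})" for d
  have U: "U d \<in> \<H>" if "d > 0" for d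
  proof -
    have "(\<lambda>f. {P\<in>\<P>. f P \<ge> ennreal d}) ` F \<subseteq> \<H>"
      using assms(2) that by (auto simp: order_measurable_def)
    then show ?thesis
      using assms(1) unfolding U_def intersection_closed_space_def hypothesis_space_def by blast
  qed
  have "{P\<in>\<P>. (SUP f\<in>F. f P) \<ge> ennreal c} = \<Inter>(U ` {0<..<c})"
  proof (intro set_eqI iffI)
    fix P assume P: "P \<in> {P\<in>\<P>. (SUP f\<in>F. f P) \<ge> ennreal c}"
    show "P \<in> \<Inter>(U ` {0<..<c})"
    proof safe
      fix d assume d: "d \<in> {0<..<c}"
      then have "ennreal d < ennreal c"
        by (simp add: ennreal_less_iff)
      then have "ennreal d < (SUP f\<in>F. f P)"
        using P by auto
      then show "P \<in> U d"
        using P by (auto simp: U_def less_SUP_iff intro: less_imp_le)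
    qed
  next
    fix P assume P: "P \<in> \<Inter>(U ` {0<..<c})"
    have le: "ennreal d \<le> (SUP f\<in>F. f P)" if "0 < d" "d < c" for d
      using P that by (force simp: U_def intro: SUP_upper2)
    have "ennreal c \<le> (SUP f\<in>F. f P)"
    proof (rule dense_le)
      fix x assume x: "x < ennreal c"
      \<comment> \<open>As \<open>x\<close> may be 0, an intermediate \<open>y\<close> is taken: it
        is finite and positive, hence an admissible level.\<close>
      then obtain y where y: "x < y" "y < ennreal c"
        using dense by blast
      then obtain d where "y = ennreal d" "0 \<le> d"
        by (cases y) auto
      then show "x \<le> (SUP f\<in>F. f P)"
        using x y le[of d] by (cases "d = 0") (auto simp: ennreal_less_iff)
    qed
    \<comment> \<open>Any single level serves here to recover \<open>P \<in> \<P>\<close>.\<close>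
    moreover have "P \<in> U (c / 2)"
      using P \<open>c > 0\<close> by auto
    ultimately show "P \<in> {P\<in>\<P>. (SUP f\<in>F. f P) \<ge> ennreal c}"
      by (auto simp: U_def)
  qed
  moreover have "U ` {0<..<c} \<subseteq> \<H>" "U ` {0<..<c} \<noteq> {}"
    using U \<open>c > 0\<close> by auto
  ultimately show "{P\<in>\<P>. (SUP f\<in>F. f P) \<ge> ennreal c} \<in> \<H>"
    using assms(1) unfolding intersection_closed_space_def by simp
qed

text \<open>On \<open>ennreal\<close>, \<open>inverse\<close> is an order-reversing involution, so
  it exchanges infima and suprema, including the empty ones.\<close>

lemma ennreal_inverse_INF:
  fixes g :: "'a \<Rightarrow> ennreal"
  shows "inverse (INF x\<in>I. g x) = (SUP x\<in>I. inverse (g x))"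
proof (rule antisym)
  have inv_inv: "inverse (inverse y) = y" for y :: ennreal
    by (cases y rule: ennreal_cases, cases "y = 0") (auto simp: inverse_ennreal)
  have "inverse (SUP x\<in>I. inverse (g x)) \<le> (INF x\<in>I. g x)"
  proof (rule INF_greatest)
    fix x assume "x \<in> I"
    then have "inverse (SUP x\<in>I. inverse (g x)) \<le> inverse (inverse (g x))"
      by (intro ennreal_inverse_antimono SUP_upper)
    then show "inverse (SUP x\<in>I. inverse (g x)) \<le> g x"
      by (simp add: inv_inv)
  qed
  then have "inverse (INF x\<in>I. g x) \<le> inverse (inverse (SUP x\<in>I. inverse (g x)))"
    by (rule ennreal_inverse_antimono)
  then show "inverse (INF x\<in>I. g x) \<le> (SUP x\<in>I. inverse (g x))"
    by (simp add: inv_inv)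
qed (auto intro!: SUP_least ennreal_inverse_antimono INF_lower)

lemma E_integral_eq_SUP_least_hypothesis:
  assumes "intersection_closed_space M \<P> \<H>" "E_measure \<H> \<epsilon>" "order_measurable \<P> \<H> f"
  shows "E_integral \<P> \<epsilon> f = (SUP P\<in>\<P>. f P / \<epsilon> (least_hypothesis \<H> P))"
proof (rule antisym)
  show "E_integral \<P> \<epsilon> f \<le> (SUP P\<in>\<P>. f P / \<epsilon> (least_hypothesis \<H> P))"
    unfolding E_integral_def
  proof (rule SUP_least)
    fix c :: real assume "c \<in> {0<..}"
    let ?A = "{P\<in>\<P>. f P \<ge> ennreal c}"
    have "?A \<in> \<H>"
      using assms(3) \<open>c \<in> {0<..}\<close> by (simp add: order_measurable_def)
    then have "ennreal c / \<epsilon> ?A = (SUP P\<in>?A. ennreal c / \<epsilon> (least_hypothesis \<H> P))"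
      by (simp only: E_measure_eq_INF_least_hypothesis[OF assms(1,2)] divide_ennreal_def
          ennreal_inverse_INF SUP_mult_left_ennreal)
    \<comment> \<open>On \<open>?A\<close> the numerator \<open>c\<close> is at most
      \<open>f P\<close>; then the index set grows to \<open>\<P>\<close>.\<close>
    also have "\<dots> \<le> (SUP P\<in>\<P>. f P / \<epsilon> (least_hypothesis \<H> P))"
      by (rule SUP_mono) (auto intro!: divide_right_mono_ennreal)
    finally show "ennreal c / \<epsilon> ?A \<le> (SUP P\<in>\<P>. f P / \<epsilon> (least_hypothesis \<H> P))" .
  qed
next
  show "(SUP P\<in>\<P>. f P / \<epsilon> (least_hypothesis \<H> P)) \<le> E_integral \<P> \<epsilon> f"
  proof (rule SUP_least)
    fix P assume P: "P \<in> \<P>"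
    show "f P / \<epsilon> (least_hypothesis \<H> P) \<le> E_integral \<P> \<epsilon> f"
    \<comment> \<open>Levels must be positive; if \<open>f P = 0\<close>, the quotient is 0, even
      over 0.\<close>
    proof (cases "f P = 0")
      case False
      then have pos: "f P > 0"
        by (simp add: zero_less_iff_neq_zero)
      let ?A = "{Q\<in>\<P>. f Q \<ge> f P}"
      have A: "?A \<in> \<H>"
        using assms(3) pos order_measurable_iff_ennreal_levels[OF assms(1)] by simp
      then have "\<epsilon> ?A \<le> \<epsilon> (least_hypothesis \<H> P)"
        using P by (intro E_measure_antimono[OF assms(2) least_hypothesis_in[OF assms(1)]]
            least_hypothesis_subset) auto
      then have "f P / \<epsilon> (least_hypothesis \<H> P) \<le> f P / \<epsilon> ?A"
        by (auto simp: divide_ennreal_def intro!: mult_left_mono ennreal_inverse_antimono)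
      \<comment> \<open>The level \<open>f P\<close> may be infinite, hence the form of the integral
        with extended levels.\<close>
      also have "\<dots> \<le> E_integral \<P> \<epsilon> f"
        unfolding E_integral_eq_ennreal_levels[OF assms] using pos by (intro SUP_upper) simp
      finally show ?thesis .
    qed simp
  qed
qed

theorem proposition9:
  fixes M :: "'a measure"
    and \<P> :: "'a measure set"
    and \<H> :: "'a measure set set"
    and \<epsilon> :: "'a measure set \<Rightarrow> ennreal"
    and F :: "('a measure \<Rightarrow> ennreal) set"
  assumes "intersection_closed_space M \<P> \<H>"
    and "E_measure \<H> \<epsilon>"
    and "\<And>f. f \<in> F \<Longrightarrow> order_measurable \<P> \<H> f"
  shows "E_integral \<P> \<epsilon> (\<lambda>P. SUP f\<in>F. f P)
         = (SUP f\<in>F. SUP P\<in>\<P>. f P / \<epsilon> (least_hypothesis \<H> P))"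
proof -
  have "E_integral \<P> \<epsilon> (\<lambda>P. SUP f\<in>F. f P)
        = (SUP P\<in>\<P>. (SUP f\<in>F. f P) / \<epsilon> (least_hypothesis \<H> P))"
    using assms by (intro E_integral_eq_SUP_least_hypothesis order_measurable_SUP)
  \<comment> \<open>Multiplication by a fixed factor commutes with suprema in
    \<open>ennreal\<close>, also for the factors 0 and \<open>\<infinity>\<close> and for empty
    \<open>F\<close>.\<close>
  also have "\<dots> = (SUP P\<in>\<P>. SUP f\<in>F. f P / \<epsilon> (least_hypothesis \<H> P))"
    by (simp only: divide_ennreal_def SUP_mult_right_ennreal)
  also have "\<dots> = (SUP f\<in>F. SUP P\<in>\<P>. f P / \<epsilon> (least_hypothesis \<H> P))"
    by (rule SUP_commute)
  finally show ?thesis .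
qed

end
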